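(* Consider the planar $n$-body problem with masses $m_1,\dots,m_n>0$ and a potential $U$ that depends only on the mutual distances $r_{ij}=|\mathbf r_i-\mathbf r_j|$, $1\le i<j\le n$. Let $x(t)=(\mathbf r_1(t),\dots,\mathbf r_n(t))$ be a solution, defined on a time interval, which is collinear, has non-zero total angular momentum, and has constant moment of inertia $I=\sum_{i=1}^n m_i|\mathbf r_i|^2$. Then $x(t)$ is a relative equilibrium.
   Context: Setting: $n$ bodies $P_1,\dots,P_n$ with masses $m_i>0$ move in the plane $\mathbb R^2$. Positions $\mathbf r_i=(x_i,y_i)$ are taken with respect to the center of mass, so $\sum_i m_i\mathbf r_i=0$. The potential depends on the mutual distances alone: $U(\mathbf r_1,\dots,\mathbf r_n)=V\big((r_{ij})_{i<j}\big)$ with $V:(0,\infty)^{n(n-1)/2}\to\mathbb R$ of class $C^1$. A solution is a twice differentiable collision-free curve ($r_{ij}(t)>0$ for all $i\neq j$ and all $t$) on an interval, satisfying $m_i\ddot{\mathbf r}_i=-\partial U/\partial\mathbf r_i$ for $i=1,\dots,n$. Collinear solution: at every time $t$ all bodies lie on a common line (which then passes through the center of mass), and this line may rotate in the plane about the center of mass. Total angular momentum: the quantity $K=\sum_{i=1}^n m_i(x_i\dot y_i-y_i\dot x_i)$, which is constant along solutions. Relative equilibrium: a solution for which, fixing an initial instant $t_0$ and writing $\mathbf r_i^0=\mathbf r_i(t_0)$, there is for every $t$ an orthogonal $2\times2$ matrix $\Omega(t)$, independent of $i$, with $\mathbf r_i(t)=\Omega(t)\mathbf r_i^0$ for every $i$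 and $t$; that is, the system rotates about the center of mass as a rigid body, with constant angular velocity and constant mutual distances. *)

theory Defs
  imports "HOL-Analysis.Analysis"
begin

text \<open>
  The bodies are indexed by an arbitrary finite linearly ordered type, so that
  \<^term>\<open>CARD('n)\<close> is the number of bodies and the pairs \<open>i < j\<close> make sense.
  A configuration is \<open>x :: real^2^'n\<close>, where \<open>x $ i\<close> is the position of body \<open>i\<close>.
\<close>

definition collision_free :: "real^2^'n \<Rightarrow> bool" where
  "collision_free x \<longleftrightarrow> (\<forall>i j. i \<noteq> j \<longrightarrow> x $ i \<noteq> x $ j)"

text \<open>
  A family \<open>(d\<^sub>i\<^sub>j)\<close> indexed by the pairs \<open>i < j\<close> is encoded as a strictly upper triangular
  matrix: the entries with \<open>i \<ge> j\<close> are fixed to be 0 and carry no information.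
\<close>

definition mutual_distances ::
    "real^2^('n::{finite,linorder}) \<Rightarrow> real^('n::{finite,linorder})^('n::{finite,linorder})" where
  "mutual_distances x = (\<chi> i j. if i < j then dist (x $ i) (x $ j) else 0)"

definition positive_orthant :: "(real^('n::{finite,linorder})^('n::{finite,linorder})) set" where
  "positive_orthant = {d. \<forall>i j. if i < j then 0 < d $ i $ j else d $ i $ j = 0}"

text \<open>
  Differentiability is taken within the orthant, which is relatively open in the space of
  strictly upper triangular matrices; so only variations of the entries with \<open>i < j\<close> matter
  (the remaining components of the gradient field \<open>G\<close> are irrelevant).
\<close>

definition C1_on_positive_orthant ::
    "(real^('n::{finite,linorder})^('n::{finite,linorder}) \<Rightarrow> real) \<Rightarrow> bool" where
  "C1_on_positive_orthant V \<longleftrightarrow>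
     (\<exists>G. continuous_on positive_orthant G \<and>
          (\<forall>d\<in>positive_orthant.
             (V has_derivative (\<lambda>h. G d \<bullet> h)) (at d within positive_orthant)))"

definition mutual_distance_potential :: "(real^2^('n::{finite,linorder}) \<Rightarrow> real) \<Rightarrow> bool" where
  "mutual_distance_potential U \<longleftrightarrow>
     (\<exists>V. C1_on_positive_orthant V \<and>
          (\<forall>x. collision_free x \<longrightarrow> U x = V (mutual_distances x)))"

text \<open>\<open>g\<close> is the partial gradient of \<open>U\<close> at \<open>x\<close> with respect to the position of body \<open>i\<close>.\<close>

definition has_partial_gradient ::
    "(real^2^'n \<Rightarrow> real) \<Rightarrow> 'n \<Rightarrow> real^2^'n \<Rightarrow> real^2 \<Rightarrow> bool" where
  "has_partial_gradient U i x g \<longleftrightarrow> (GDERIV (\<lambda>y. U (\<chi> k. if k = i then y else x $ k)) (x $ i) :> g)"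

text \<open>Derivatives along curves are relative to \<open>T\<close>, i.e. one-sided at endpoints belonging to \<open>T\<close>.\<close>

definition velocity :: "real set \<Rightarrow> (real \<Rightarrow> real^2^'n) \<Rightarrow> real \<Rightarrow> real^2^'n" where
  "velocity T x t = vector_derivative x (at t within T)"

definition n_body_solution ::
    "('n::finite \<Rightarrow> real) \<Rightarrow> (real^2^'n \<Rightarrow> real) \<Rightarrow> real set \<Rightarrow> (real \<Rightarrow> real^2^'n) \<Rightarrow> bool" where
  "n_body_solution m U T x \<longleftrightarrow>
     x differentiable_on T \<and>
     velocity T x differentiable_on T \<and>
     (\<forall>t\<in>T. collision_free (x t) \<and>
            (\<Sum>i\<in>UNIV. m i *\<^sub>R x t $ i) = 0 \<and>
            (\<forall>i. \<exists>g. has_partial_gradient U i (x t) g \<and>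
                     m i *\<^sub>R velocity T (velocity T x) t $ i = - g))"

definition collinear_motion :: "real set \<Rightarrow> (real \<Rightarrow> real^2^'n) \<Rightarrow> bool" where
  "collinear_motion T x \<longleftrightarrow> (\<forall>t\<in>T. collinear (range (\<lambda>i. x t $ i)))"

definition moment_of_inertia :: "('n::finite \<Rightarrow> real) \<Rightarrow> real^2^'n \<Rightarrow> real" where
  "moment_of_inertia m x = (\<Sum>i\<in>UNIV. m i * (norm (x $ i))\<^sup>2)"

definition angular_momentum :: "('n::finite \<Rightarrow> real) \<Rightarrow> real^2^'n \<Rightarrow> real^2^'n \<Rightarrow> real" where
  "angular_momentum m x v = (\<Sum>i\<in>UNIV. m i * (x $ i $ 1 * v $ i $ 2 - x $ i $ 2 * v $ i $ 1))"

text \<open>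
  In a relative equilibrium the configuration at time \<open>t\<close> is the image of the one at time \<open>t0\<close>
  under an orthogonal matrix \<open>\<Omega> t\<close>, the same for all bodies. The constant \<open>\<omega>\<close> is the angular velocity: a
  rotation about the origin with angular velocity \<open>\<omega>\<close> has velocity field
  \<open>(a, b) \<mapsto> \<omega> (- b, a)\<close>.
\<close>

definition relative_equilibrium ::
    "('n::finite \<Rightarrow> real) \<Rightarrow> (real^2^'n \<Rightarrow> real) \<Rightarrow> real set \<Rightarrow> (real \<Rightarrow> real^2^'n) \<Rightarrow> bool" where
  "relative_equilibrium m U T x \<longleftrightarrow>
     n_body_solution m U T x \<and>
     (\<forall>t0\<in>T. \<exists>\<Omega> :: real \<Rightarrow> real^2^2. \<forall>t\<in>T.
        orthogonal_matrix (\<Omega> t) \<and> (\<forall>i. x t $ i = \<Omega> t *v (x t0 $ i))) \<and>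
     (\<exists>\<omega>. \<forall>t\<in>T. \<forall>i. velocity T x t $ i = \<omega> *\<^sub>R vector [- (x t $ i $ 2), x t $ i $ 1]) \<and>
     (\<forall>i j. (\<lambda>t. dist (x t $ i) (x t $ j)) constant_on T)"

end

theory Submission imports Defs begin

text \<open>
  Moving one body of a collinear configuration orthogonally to the line by \<open>s\<close> or by \<open>- s\<close> gives
  the same mutual distances, so the force on it is along the line. Hence the angular momentum of
  each body is conserved separately. As the bodies stay on one line through the origin, these
  angular momenta are proportional to the squared distances to the origin, with factor \<open>K / I\<close>.
  So each of these distances is constant, and each body moves with the angular velocity \<open>K / I\<close>.
\<close>

section \<open>Cross product and quarter turn in the plane\<close>

definition cross2 :: "real^2 \<Rightarrow> real^2 \<Rightarrow> real" where
  "cross2 p q = p $ 1 * q $ 2 - p $ 2 * q $ 1"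

text \<open>The counterclockwise quarter turn, spelled like the velocity condition of
  \<open>relative_equilibrium\<close> so that unfolding makes the two agree.\<close>

definition perp :: "real^2 \<Rightarrow> real^2" where
  "perp p = vector [- (p $ 2), p $ 1]"

lemma perp_nth [simp]: "perp p $ 1 = - (p $ 2)" "perp p $ 2 = p $ 1"
  by (simp_all add: perp_def)

lemma inner_real2: "(p::real^2) \<bullet> q = p $ 1 * q $ 1 + p $ 2 * q $ 2"
  by (simp add: inner_vec_def sum_2)

text \<open>The second hypothesis is the time derivative of the first when \<open>v\<close> and
  \<open>w\<close> are the velocities of \<open>p\<close> and \<open>q\<close>. Writing
  \<open>p = a e\<close> and \<open>q = b e\<close> with a unit vector \<open>e\<close>, it reads
  \<open>b * cross2 e v = a * cross2 e w\<close>; multiplying by \<open>a * b\<close> gives the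
  claim, also when \<open>a\<close> or \<open>b\<close> is 0.\<close>

lemma cross2_proportional:
  assumes "cross2 p q = 0" and "cross2 v q + cross2 p w = 0"
  shows "cross2 p v * (q \<bullet> q) = (p \<bullet> p) * cross2 q w"
  using assms unfolding cross2_def inner_real2 by algebra

text \<open>\<open>p\<close> and \<open>perp p\<close> form an orthogonal basis, and
  \<open>cross2 p v\<close> is the inner product of \<open>v\<close> with \<open>perp p\<close>; so
  both coordinates of \<open>v\<close> are prescribed.\<close>

lemma velocity_eq_perp:
  assumes "p \<noteq> 0" "p \<bullet> v = 0" "cross2 p v = c * (p \<bullet> p)"
  shows "v = c *\<^sub>R perp p"
proof -
  have "(p \<bullet> p) * v $ 1 = (p \<bullet> p) * (- c * p $ 2)" "(p \<bullet> p) * v $ 2 = (p \<bullet> p) * (c * p $ 1)"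
    using assms(2,3) unfolding cross2_def inner_real2 by algebra+
  then show ?thesis
    using assms(1) by (simp only: mult_cancel_left inner_eq_zero_iff) (simp add: vec_eq_iff forall_2)
qed

section \<open>Collinear configurations and the force on one body\<close>

text \<open>The mass-weighted mean of the differences \<open>r i - r j\<close> over \<open>j\<close>
  is \<open>r i\<close> itself, because the barycenter is 0. All differences are multiples of
  \<open>u\<close>, hence so is every position.\<close>

lemma collinear_barycenter_cross2:
  fixes r :: "'n::finite \<Rightarrow> real^2"
  assumes masses: "\<And>i. 0 < m i"
    and bary: "(\<Sum>i\<in>UNIV. m i *\<^sub>R r i) = 0"
    and col: "collinear (range r)"
  shows "cross2 (r i) (r j) = 0"
proof -
  obtain u where u: "\<And>p q. p \<in> range r \<Longrightarrow> q \<in> range r \<Longrightarrow> \<exists>c. p - q = c *\<^sub>R u"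
    using col unfolding collinear_def by blast
  have M: "(\<Sum>i\<in>UNIV. m i) > 0"
    using masses by (simp add: sum_pos)
  have "\<exists>c. r i = c *\<^sub>R u" for i
  proof -
    have "\<exists>c. \<forall>j. r i - r j = c j *\<^sub>R u"
      using u by (intro choice) blast
    then obtain c where c: "\<And>j. r i - r j = c j *\<^sub>R u" by blast
    have "(\<Sum>j\<in>UNIV. m j) *\<^sub>R r i = (\<Sum>j\<in>UNIV. m j *\<^sub>R (r i - r j))"
      using bary by (simp add: scaleR_diff_right sum_subtractf scaleR_sum_left)
    also have "\<dots> = (\<Sum>j\<in>UNIV. m j * c j) *\<^sub>R u"
      by (simp add: c scaleR_sum_left)
    finally have "(\<Sum>j\<in>UNIV. m j) *\<^sub>R r i = (\<Sum>j\<in>UNIV. m j * c j) *\<^sub>R u" .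
    then have "r i = (inverse (\<Sum>j\<in>UNIV. m j) * (\<Sum>j\<in>UNIV. m j * c j)) *\<^sub>R u"
      using M by (metis less_irrefl left_inverse scaleR_one scaleR_scaleR)
    then show ?thesis by blast
  qed
  then obtain c d where "r i = c *\<^sub>R u" "r j = d *\<^sub>R u" by meson
  then show ?thesis by (simp add: cross2_def)
qed

text \<open>Along the line through \<open>x $ i\<close> in direction \<open>n\<close> the potential
  is an even function \<open>h\<close> of the displacement, by Pythagoras. Its derivative at 0 is
  \<open>g \<bullet> n\<close>, and an even function has derivative 0 there.\<close>

lemma partial_gradient_orthogonal:
  fixes x :: "real^2^'n::{finite,linorder}"
  assumes potential: "mutual_distance_potential U"
    and free: "collision_free x"
    and grad: "has_partial_gradient U i x g"
    and orth: "\<And>j. (x $ i - x $ j) \<bullet> n = 0"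
  shows "g \<bullet> n = 0"
proof -
  define X where "X y = (\<chi> k. if k = i then y else x $ k)" for y
  define h where "h s = U (X (x $ i + s *\<^sub>R n))" for s
  have dist_sq: "(dist (x $ i + s *\<^sub>R n) (x $ j))\<^sup>2 = (dist (x $ i) (x $ j))\<^sup>2 + s\<^sup>2 * (n \<bullet> n)" for s j
  proof -
    have "(x $ i + s *\<^sub>R n) - x $ j = (x $ i - x $ j) + s *\<^sub>R n" by simp
    then show ?thesis
      using orth[of j]
      by (simp only: dist_norm power2_norm_eq_inner)
        (simp add: inner_add inner_commute power2_eq_square)
  qed
  \<comment> \<open>\<open>U\<close> is a function of the distances only at collision-free
    configurations; the displacement cannot shorten a distance, so it creates no collision.\<close>
  have free_X: "collision_free (X (x $ i + s *\<^sub>R n))" for s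
  proof -
    have "x $ i + s *\<^sub>R n \<noteq> x $ j" if "j \<noteq> i" for j
    proof
      assume "x $ i + s *\<^sub>R n = x $ j"
      then have "(dist (x $ i) (x $ j))\<^sup>2 + s\<^sup>2 * (n \<bullet> n) = 0"
        using dist_sq[of s j] by simp
      moreover have "(dist (x $ i) (x $ j))\<^sup>2 > 0"
        using free that by (auto simp: collision_free_def)
      ultimately show False
        using mult_nonneg_nonneg[OF zero_le_power2[of s] inner_ge_zero[of n]] by linarith
    qed
    then show ?thesis
      using free unfolding collision_free_def X_def by (simp, metis)
  qed
  have dist_neg: "dist (x $ i + s *\<^sub>R n) (x $ j) = dist (x $ i + (- s) *\<^sub>R n) (x $ j)" for s j
  proof (rule power2_eq_imp_eq)
    show "(dist (x $ i + s *\<^sub>R n) (x $ j))\<^sup>2 = (dist (x $ i + (- s) *\<^sub>R n) (x $ j))\<^sup>2"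
      unfolding dist_sq by simp
  qed (rule zero_le_dist)+
  have "mutual_distances (X (x $ i + s *\<^sub>R n)) = mutual_distances (X (x $ i + (- s) *\<^sub>R n))" for s
  proof -
    \<comment> \<open>The moved body is the first or the second of a pair depending on the index
      order, so both argument orders are needed.\<close>
    have "dist (x $ j) (x $ i + s *\<^sub>R n) = dist (x $ j) (x $ i + (- s) *\<^sub>R n)" for j
      using dist_neg[of s j] by (simp only: dist_commute)
    with dist_neg[of s] show ?thesis
      unfolding mutual_distances_def X_def by (simp only: vec_eq_iff vec_lambda_beta) auto
  qed
  then have even: "h (- s) = h s" for s
    using potential free_X unfolding mutual_distance_potential_def h_def by metis
  have "((\<lambda>y. U (X y)) has_derivative (\<lambda>v. v \<bullet> g)) (at (x $ i + 0 *\<^sub>R n))"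
    using grad unfolding has_partial_gradient_def gderiv_def X_def by simp
  moreover have "((\<lambda>s. x $ i + s *\<^sub>R n) has_derivative (\<lambda>s. s *\<^sub>R n)) (at 0)"
    by (auto intro!: derivative_eq_intros)
  ultimately have "(h has_derivative (\<lambda>s. (s *\<^sub>R n) \<bullet> g)) (at 0)"
    unfolding h_def by (rule has_derivative_compose[rotated])
  then have D: "(h has_real_derivative (g \<bullet> n)) (at 0)"
    unfolding has_field_derivative_def by (simp add: inner_commute mult_commute_abs)
  then have "((\<lambda>s. h (- s)) has_real_derivative (g \<bullet> n) * (- 1)) (at 0)"
    by (intro DERIV_chain2[where f = h]) (auto intro!: derivative_eq_intros)
  then have "(h has_real_derivative - (g \<bullet> n)) (at 0)"
    by (simp add: even)
  with D have "g \<bullet> n = - (g \<bullet> n)" by (rule DERIV_unique)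
  then show ?thesis by simp
qed

section \<open>Derivatives relative to an interval\<close>

lemma has_real_derivative_zero_constant_on:
  fixes f :: "real \<Rightarrow> real"
  assumes "is_interval T" and "\<And>t. t \<in> T \<Longrightarrow> (f has_real_derivative 0) (at t within T)"
    and "s \<in> T" "t \<in> T"
  shows "f s = f t"
proof -
  have "\<exists>c. \<forall>t\<in>T. f t = c"
    using assms(1,2) by (intro has_field_derivative_zero_constant) (auto simp: is_interval_convex_1)
  then show ?thesis using assms(3,4) by auto
qed

text \<open>A derivative within \<open>T\<close> is unique only at a non-isolated point of
  \<open>T\<close>, whence the condition on the filter.\<close>

lemma constant_on_imp_derivative_zero:
  fixes f :: "real \<Rightarrow> real"
  assumes "(f has_real_derivative D) (at t within T)" and "at t within T \<noteq> bot"
    and "t \<in> T" and "\<And>s. s \<in> T \<Longrightarrow> f s = c"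
  shows "D = 0"
proof -
  have "(f has_real_derivative 0) (at t within T)"
    by (rule has_field_derivative_transform_within[where f = "\<lambda>_. c" and d = 1])
      (use assms(3,4) in auto)
  then show ?thesis
    using assms(1,2) by (metis has_real_derivative_iff_has_vector_derivative
        vector_derivative_within)
qed

lemma at_within_interval_nontrivial:
  fixes T :: "real set"
  assumes "is_interval T" "a \<in> T" "b \<in> T" "a < b" "t \<in> T"
  shows "at t within T \<noteq> bot"
proof -
  have "t islimpt T"
    using assms by (intro connected_imp_perfect) (auto simp: is_interval_connected_1)
  then show ?thesis by (simp add: trivial_limit_within)
qed

lemma velocity_nth_has_derivative:
  assumes "y differentiable_on T" "t \<in> T"
  shows "((\<lambda>s. y s $ i $ k) has_real_derivative velocity T y t $ i $ k) (at t within T)"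
proof -
  have "(y has_vector_derivative velocity T y t) (at t within T)"
    using assms unfolding velocity_def differentiable_on_def
    by (simp add: vector_derivative_works[symmetric])
  then have "((\<lambda>s. y s $ i $ k) has_vector_derivative velocity T y t $ i $ k) (at t within T)"
    by (intro bounded_linear.has_vector_derivative[OF bounded_linear_vec_nth])
  then show ?thesis
    by (simp add: has_real_derivative_iff_has_vector_derivative)
qed

section \<open>Uniform rotation\<close>

definition rotation :: "real \<Rightarrow> real^2^2" where
  "rotation a = vector [vector [cos a, - sin a], vector [sin a, cos a]]"

lemma rotation_mult_nth:
  "(rotation a *v p) $ 1 = cos a * p $ 1 - sin a * p $ 2"
  "(rotation a *v p) $ 2 = sin a * p $ 1 + cos a * p $ 2"
  by (simp_all add: rotation_def matrix_vector_mult_def sum_2)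

lemma orthogonal_matrix_rotation: "orthogonal_matrix (rotation a)"
  unfolding orthogonal_matrix
  using sin_cos_squared_add3[of a]
  by (simp add: rotation_def matrix_matrix_mult_def transpose_def mat_def vec_eq_iff forall_2 sum_2
      add.commute)

text \<open>Seen from the frame turning with angular velocity \<omega>, the point is at rest: its
  coordinates \<open>A\<close> and \<open>B\<close> there have derivative 0. Turning back gives the
  formula.\<close>

lemma rotating_motion:
  fixes p :: "real \<Rightarrow> real^2"
  assumes T: "is_interval T"
    and D1: "\<And>t. t \<in> T \<Longrightarrow> ((\<lambda>t. p t $ 1) has_real_derivative - (\<omega> * p t $ 2)) (at t within T)"
    and D2: "\<And>t. t \<in> T \<Longrightarrow> ((\<lambda>t. p t $ 2) has_real_derivative \<omega> * p t $ 1) (at t within T)"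
    and t: "t0 \<in> T" "t \<in> T"
  shows "p t = rotation (\<omega> * (t - t0)) *v p t0"
proof -
  define \<phi> where "\<phi> s = \<omega> * (s - t0)" for s
  define A where "A s = cos (\<phi> s) * p s $ 1 + sin (\<phi> s) * p s $ 2" for s
  define B where "B s = cos (\<phi> s) * p s $ 2 - sin (\<phi> s) * p s $ 1" for s
  have D\<phi>: "(\<phi> has_real_derivative \<omega>) (at s within T)" for s
    unfolding \<phi>_def by (auto intro!: derivative_eq_intros)
  have "(A has_real_derivative 0) (at s within T)" if "s \<in> T" for s
    unfolding A_def using D1[OF that] D2[OF that] D\<phi>[of s]
    by (auto intro!: derivative_eq_intros simp: algebra_simps)
  from has_real_derivative_zero_constant_on[OF T this t(2,1)] have A: "A t = p t0 $ 1"
    by (simp add: A_def[of t0] \<phi>_def)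
  have "(B has_real_derivative 0) (at s within T)" if "s \<in> T" for s
    unfolding B_def using D1[OF that] D2[OF that] D\<phi>[of s]
    by (auto intro!: derivative_eq_intros simp: algebra_simps)
  from has_real_derivative_zero_constant_on[OF T this t(2,1)] have B: "B t = p t0 $ 2"
    by (simp add: B_def[of t0] \<phi>_def)
  have "p t $ 1 = cos (\<phi> t) * A t - sin (\<phi> t) * B t" "p t $ 2 = sin (\<phi> t) * A t + cos (\<phi> t) * B t"
    unfolding A_def B_def using sin_cos_squared_add[of "\<phi> t"] by algebra+
  then show ?thesis
    by (simp add: vec_eq_iff forall_2 rotation_mult_nth A B \<phi>_def)
qed

text \<open>The angle depends only on \<omega> and the two times, so one rotation serves all bodies
  and preserves their distances.\<close>

lemma rotating_relative_equilibrium: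
  fixes m :: "'n::finite \<Rightarrow> real"
  assumes T: "is_interval T"
    and solution: "n_body_solution m U T x"
    and vel: "\<And>t i. t \<in> T \<Longrightarrow> velocity T x t $ i = \<omega> *\<^sub>R perp (x t $ i)"
  shows "relative_equilibrium m U T x"
proof -
  have diff: "x differentiable_on T"
    using solution by (simp add: n_body_solution_def)
  have rot: "x t $ i = rotation (\<omega> * (t - t0)) *v (x t0 $ i)" if "t0 \<in> T" "t \<in> T" for t0 t i
  proof (rule rotating_motion[OF T _ _ that])
    fix s assume "s \<in> T"
    then show "((\<lambda>s. x s $ i $ 1) has_real_derivative - (\<omega> * x s $ i $ 2)) (at s within T)"
      "((\<lambda>s. x s $ i $ 2) has_real_derivative \<omega> * x s $ i $ 1) (at s within T)"
      using velocity_nth_has_derivative[OF diff, of s i 1] vel[of s i]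
        velocity_nth_has_derivative[OF diff, of s i 2] by simp_all
  qed
  have dist: "dist (x t $ i) (x t $ j) = dist (x t0 $ i) (x t0 $ j)" if "t0 \<in> T" "t \<in> T" for t0 t i j
  proof -
    have "orthogonal_transformation ((*v) (rotation (\<omega> * (t - t0))))"
      using orthogonal_matrix_rotation by (simp add: orthogonal_transformation_matrix)
    then show ?thesis
      by (simp add: rot[OF that] orthogonal_transformation_isometry)
  qed
  then have "(\<lambda>t. dist (x t $ i) (x t $ j)) constant_on T" for i j
    unfolding constant_on_def by (metis (no_types, lifting))
  moreover have "\<exists>\<Omega> :: real \<Rightarrow> real^2^2. \<forall>t\<in>T.
      orthogonal_matrix (\<Omega> t) \<and> (\<forall>i. x t $ i = \<Omega> t *v (x t0 $ i))" if "t0 \<in> T" for t0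
    using rot[OF that] orthogonal_matrix_rotation
    by (intro exI[of _ "\<lambda>t. rotation (\<omega> * (t - t0))"]) blast
  ultimately show ?thesis
    using solution vel unfolding relative_equilibrium_def perp_def by blast
qed

section \<open>Individual angular momenta, constant radii and the common angular velocity\<close>

theorem corollary1:
  fixes m :: "'n::{finite,linorder} \<Rightarrow> real"
    and U :: "real^2^('n::{finite,linorder}) \<Rightarrow> real"
    and T :: "real set"
    and x :: "real \<Rightarrow> real^2^('n::{finite,linorder})"
  assumes masses: "\<And>i. 0 < m i"
    and potential: "mutual_distance_potential U"
    and interval: "is_interval T" "\<exists>a\<in>T. \<exists>b\<in>T. a < b"
    and solution: "n_body_solution m U T x"
    and collinear: "collinear_motion T x"
    and nonzero_momentum: "\<exists>t\<in>T. angular_momentum m (x t) (velocity T x t) \<noteq> 0"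
    and constant_inertia: "(\<lambda>t. moment_of_inertia m (x t)) constant_on T"
  shows "relative_equilibrium m U T x"
proof -
  define v where "v = velocity T x"
  \<comment> \<open>The angular momentum of body \<open>i\<close> per unit mass.\<close>
  define l where "l i t = cross2 (x t $ i) (v t $ i)" for i t
  have diff: "x differentiable_on T" "v differentiable_on T"
    using solution by (simp_all add: n_body_solution_def v_def)
  note Dx = velocity_nth_has_derivative[OF diff(1), folded v_def]
  note Dv = velocity_nth_has_derivative[OF diff(2)]
  have nontrivial: "at t within T \<noteq> bot" if "t \<in> T" for t
    using interval that at_within_interval_nontrivial by metis
  have par: "cross2 (x t $ i) (x t $ j) = 0" if "t \<in> T" for t i j
    using solution collinear that masses
    by (intro collinear_barycenter_cross2[where m = m])
      (auto simp: n_body_solution_def collinear_motion_def)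

  \<comment> \<open>All positions are parallel, so \<open>perp (x t $ i)\<close> is orthogonal to
    every difference from body \<open>i\<close> and hence to the gradient; that inner product is the
    torque up to sign.\<close>
  have torque: "cross2 (x t $ i) (velocity T v t $ i) = 0" if t: "t \<in> T" for t i
  proof -
    obtain g where g: "has_partial_gradient U i (x t) g"
      and eq: "m i *\<^sub>R velocity T v t $ i = - g" and free: "collision_free (x t)"
      using solution t unfolding n_body_solution_def v_def by blast
    have "(x t $ i - x t $ j) \<bullet> perp (x t $ i) = 0" for j
      using par[OF t, of i j] by (simp add: cross2_def inner_real2 algebra_simps)
    then have "g \<bullet> perp (x t $ i) = 0"
      using partial_gradient_orthogonal[OF potential free g] by blast
    moreover have "g = - (m i *\<^sub>R velocity T v t $ i)"
      using eq by simp
    ultimately have "m i * cross2 (x t $ i) (velocity T v t $ i) = 0"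
      by (auto simp: cross2_def inner_real2 algebra_simps)
    then show ?thesis using masses[of i] by simp
  qed
  have l_const: "l i s = l i t" if "s \<in> T" "t \<in> T" for i s t
  proof (rule has_real_derivative_zero_constant_on[OF interval(1) _ that])
    fix r assume r: "r \<in> T"
    show "(l i has_real_derivative 0) (at r within T)"
      unfolding l_def cross2_def
      using Dx[OF r, of i 1] Dx[OF r, of i 2] Dv[OF r, of i 1] Dv[OF r, of i 2] torque[OF r, of i]
      by (auto intro!: derivative_eq_intros simp: cross2_def algebra_simps)
  qed

  \<comment> \<open>Positions are parallel at all times, so the cross product of two of them
    vanishes identically on \<open>T\<close>, and so does its derivative.\<close>
  have ratio: "l i t * (x t $ j \<bullet> x t $ j) = (x t $ i \<bullet> x t $ i) * l j t" if t: "t \<in> T" for i j t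
    unfolding l_def
  proof (rule cross2_proportional[OF par[OF t]])
    have "((\<lambda>t. cross2 (x t $ i) (x t $ j)) has_real_derivative
        cross2 (v t $ i) (x t $ j) + cross2 (x t $ i) (v t $ j)) (at t within T)"
      unfolding cross2_def
      using Dx[OF t, of i 1] Dx[OF t, of i 2] Dx[OF t, of j 1] Dx[OF t, of j 2]
      by (auto intro!: derivative_eq_intros simp: algebra_simps)
    then show "cross2 (v t $ i) (x t $ j) + cross2 (x t $ i) (v t $ j) = 0"
      using constant_on_imp_derivative_zero[OF _ nontrivial[OF t] t] par by blast
  qed

  obtain I where I: "\<And>t. t \<in> T \<Longrightarrow> (\<Sum>j\<in>UNIV. m j * (x t $ j \<bullet> x t $ j)) = I"
    using constant_inertia
    unfolding constant_on_def moment_of_inertia_def power2_norm_eq_inner by blast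
  obtain t1 where t1: "t1 \<in> T" "(\<Sum>j\<in>UNIV. m j * l j t1) \<noteq> 0"
    using nonzero_momentum unfolding angular_momentum_def l_def cross2_def v_def by blast
  define K where "K = (\<Sum>j\<in>UNIV. m j * l j t1)"
  have K: "(\<Sum>j\<in>UNIV. m j * l j t) = K" if "t \<in> T" for t
    using l_const[OF that t1(1)] by (simp add: K_def)
  \<comment> \<open>Weight \<open>ratio\<close> by \<open>m j\<close> and sum over \<open>j\<close>.
    The form without division also covers a body at the origin.\<close>
  have lI: "l i t * I = (x t $ i \<bullet> x t $ i) * K" if t: "t \<in> T" for i t
  proof -
    have "l i t * I = (\<Sum>j\<in>UNIV. m j * (l i t * (x t $ j \<bullet> x t $ j)))"
      by (simp add: I[OF t, symmetric] sum_distrib_left algebra_simps)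
    also have "\<dots> = (\<Sum>j\<in>UNIV. m j * ((x t $ i \<bullet> x t $ i) * l j t))"
      by (simp only: ratio[OF t, of i])
    also have "\<dots> = (x t $ i \<bullet> x t $ i) * K"
      by (simp add: K[OF t, symmetric] sum_distrib_left mult.left_commute)
    finally show ?thesis .
  qed
  have "K \<noteq> 0" using t1 by (simp add: K_def)
  \<comment> \<open>Otherwise \<open>lI\<close> puts every body at the origin at time
    \<open>t1\<close>, where the momentum is non-zero.\<close>
  have "I \<noteq> 0"
  proof
    assume "I = 0"
    then have "x t1 $ i = 0" for i
      using lI[OF t1(1), of i] \<open>K \<noteq> 0\<close> by simp
    then show False using t1(2) by (simp add: l_def cross2_def)
  qed

  \<comment> \<open>In \<open>lI\<close> the left side is constant in time; the non-zero momentum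
    \<open>K\<close> can be cancelled on the right.\<close>
  have r_const: "x s $ i \<bullet> x s $ i = x t $ i \<bullet> x t $ i" if "s \<in> T" "t \<in> T" for i s t
    using lI[OF that(1), of i] lI[OF that(2), of i] l_const[OF that, of i] \<open>K \<noteq> 0\<close> by simp
  have "v t $ i = (K / I) *\<^sub>R perp (x t $ i)" if t: "t \<in> T" for i t
  proof (cases "x t $ i = 0")
    \<comment> \<open>Constant radius keeps such a body at the origin throughout, so its velocity is
      0.\<close>
    case True
    then have "x s $ i = 0" if "s \<in> T" for s
      using r_const[OF that t, of i] by simp
    then have "v t $ i $ k = 0" for k
      using constant_on_imp_derivative_zero[OF Dx[OF t, of i k] nontrivial[OF t] t, of 0] by simp
    then show ?thesis
      using True by (simp add: vec_eq_iff forall_2)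
  next
    case False
    \<comment> \<open>Constant radius makes the velocity orthogonal to the position;
      \<open>lI\<close> supplies its component along \<open>perp (x t $ i)\<close>.\<close>
    have "((\<lambda>t. x t $ i \<bullet> x t $ i) has_real_derivative 2 * (x t $ i \<bullet> v t $ i)) (at t within T)"
      unfolding inner_real2 using Dx[OF t, of i 1] Dx[OF t, of i 2]
      by (auto intro!: derivative_eq_intros simp: algebra_simps)
    then have "2 * (x t $ i \<bullet> v t $ i) = 0"
      using constant_on_imp_derivative_zero[OF _ nontrivial[OF t] t] r_const[OF _ t] by blast
    moreover have "cross2 (x t $ i) (v t $ i) = (K / I) * (x t $ i \<bullet> x t $ i)"
      using lI[OF t, of i] \<open>I \<noteq> 0\<close> by (simp add: l_def field_simps)
    ultimately show ?thesis
      using velocity_eq_perp[OF False] by simp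
  qed
  then show ?thesis
    using rotating_relative_equilibrium[OF interval(1) solution] unfolding v_def by blast
qed

end
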